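(* Let $\sigma>0$, $k>0$ and $$J(s)=k^2(\sigma-s)^2+\frac{s^2}{1+s^2},\qquad s>0,\qquad J_{\mathrm G}^\star=\inf_{s>0}J(s).$$ The infimum $J_{\mathrm G}^\star$ is attained at an interior point $s^\star>0$, and every stationary point $s>0$ of $J$ satisfies $$k^2(\sigma-s)=\frac{s}{(1+s^2)^2},$$ equivalently the quintic $k^2(\sigma-s)(1+2s^2+s^4)-s=0$. Moreover, $J$ is strictly convex on $(0,\infty)$ when $k^2>\tfrac14$, in which case the stationarity equation has a unique root in $(0,\infty)$ and $s^\star$ is unique. For $k^2\le\tfrac14$, $J$ may be non-convex and the stationarity equation may possess several positive roots: for instance, for $k=0.2$ and $\sigma=5$ it has three positive roots (two local minima of $J$ separated by a local maximum), and the global minimizer is selected by comparing the values $J(s)$.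
   Context: $J(s)$ is the value of $k^2W_2^2(P,Q)+\operatorname{mmse}(Q)$ for $P=\mathcal N(0,\sigma^2)$ and $Q=\mathcal N(0,s^2)$, where $\operatorname{mmse}(Q)=\mathbb E[\operatorname{Var}(Y\mid Y+N)]$ with $Y\sim Q$, $N\sim\mathcal N(0,1)$ independent; only the explicit formula in the claim is needed. *)

theory Defs
  imports "HOL-Analysis.Analysis"
begin

(* J is only ever used on the open half-line s > 0. For s > 0 it is the value of
   k^2 W_2^2(P,Q) + mmse(Q) at P = N(0, \<sigma>^2), Q = N(0, s^2). *)
definition J :: "real \<Rightarrow> real \<Rightarrow> real \<Rightarrow> real" where
  "J \<sigma> k s = k\<^sup>2 * (\<sigma> - s)\<^sup>2 + s\<^sup>2 / (1 + s\<^sup>2)"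

(* J is bounded below by 0, so the real-valued infimum is the genuine one. *)
definition JG :: "real \<Rightarrow> real \<Rightarrow> real" where
  "JG \<sigma> k = (INF s\<in>{0<..}. J \<sigma> k s)"

definition global_minimizer :: "real \<Rightarrow> real \<Rightarrow> real \<Rightarrow> bool" where
  "global_minimizer \<sigma> k s \<longleftrightarrow> s > 0 \<and> J \<sigma> k s = JG \<sigma> k"

definition stationary_point :: "(real \<Rightarrow> real) \<Rightarrow> real \<Rightarrow> bool" where
  "stationary_point f s \<longleftrightarrow> (f has_real_derivative 0) (at s)"

definition stationarity_eq :: "real \<Rightarrow> real \<Rightarrow> real \<Rightarrow> bool" where
  "stationarity_eq \<sigma> k s \<longleftrightarrow> k\<^sup>2 * (\<sigma> - s) = s / (1 + s\<^sup>2)\<^sup>2"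

definition stationarity_quintic :: "real \<Rightarrow> real \<Rightarrow> real \<Rightarrow> bool" where
  "stationarity_quintic \<sigma> k s \<longleftrightarrow> k\<^sup>2 * (\<sigma> - s) * (1 + 2 * s\<^sup>2 + s^4) - s = 0"

definition strictly_convex_on :: "'a::real_vector set \<Rightarrow> ('a \<Rightarrow> real) \<Rightarrow> bool" where
  "strictly_convex_on S f \<longleftrightarrow> convex S \<and>
    (\<forall>x\<in>S. \<forall>y\<in>S. \<forall>u>0. \<forall>v>0. x \<noteq> y \<longrightarrow> u + v = 1 \<longrightarrow>
      f (u *\<^sub>R x + v *\<^sub>R y) < u * f x + v * f y)"

definition local_minimum :: "(real \<Rightarrow> real) \<Rightarrow> real \<Rightarrow> bool" where
  "local_minimum f s \<longleftrightarrow> (\<forall>\<^sub>F x in nhds s. f s \<le> f x)"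

definition local_maximum :: "(real \<Rightarrow> real) \<Rightarrow> real \<Rightarrow> bool" where
  "local_maximum f s \<longleftrightarrow> (\<forall>\<^sub>F x in nhds s. f x \<le> f s)"

end

theory Submission
  imports Defs
begin

text \<open>
  The halved derivative of \<open>J\<close> has derivative
  \<open>k\<^sup>2 + (1 - 3u) / (1 + u)\<^sup>3\<close> with \<open>u = s\<^sup>2\<close>, and
  \<open>4 (1 - 3u) + (1 + u)\<^sup>3 = (u - 1)\<^sup>2 (u + 5) \<ge> 0\<close>, so it is increasing once \<open>k\<^sup>2 > 1/4\<close>.
  Since \<open>J\<close> decreases at 0 and stays above \<open>J(\<sigma>)\<close> beyond \<open>\<sigma>\<close>, its minimum over
  \<open>[0, \<sigma>]\<close> is interior and global.  For \<open>k = 0.2\<close>, \<open>\<sigma> = 5\<close> the halved derivative is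
  monotone on \<open>[0, 1/2]\<close>, \<open>[1, 2]\<close> and \<open>[3, \<infinity>)\<close>, changing sign once on each,
  and has no zero on \<open>[1/2, 1]\<close> and \<open>[2, 3]\<close>.
\<close>

section \<open>Derivative criteria for convexity, local extrema and monotonicity\<close>

text \<open>By the mean value theorem the chords of \<open>f\<close> on the two sides of a convex
  combination have slopes \<open>f' c\<close> and \<open>f' d\<close> with \<open>c < d\<close>, so
  the left chord is strictly less steep than the right one.\<close>

lemma strictly_convex_on_if_deriv_strict_mono_on:
  fixes f f' :: "real \<Rightarrow> real"
  assumes S: "convex S"
    and der: "\<And>x. x \<in> S \<Longrightarrow> (f has_real_derivative f' x) (at x)"
    and mono: "strict_mono_on S f'"
  shows "strictly_convex_on S f"
proof -
  have less: "f (u * x + v * y) < u * f x + v * f y"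
    if "x \<in> S" "y \<in> S" "x < y" and uv: "u > 0" "v > 0" "u + v = 1" for x y u v
  proof -
    define z where "z = u * x + v * y"
    have u: "u = 1 - v" using uv by simp
    \<comment> \<open>Weighting the left increment by \<open>u\<close> and the right one by
      \<open>v\<close> gives both the common factor \<open>u * v * (y - x)\<close>, so that only
      \<open>f' c\<close> and \<open>f' d\<close> remain to be compared.\<close>
    have zx: "z - x = v * (y - x)" and yz: "y - z = u * (y - x)"
      unfolding z_def u by (simp_all add: algebra_simps)
    have "x < z" "z < y" using zx yz uv \<open>x < y\<close>
      by (metis diff_gt_0_iff_gt mult_pos_pos)+
    have "is_interval S" using S by (simp add: is_interval_convex_1)
    then have in_S: "t \<in> S" if "x \<le> t" "t \<le> y" for t
      using that \<open>x \<in> S\<close> \<open>y \<in> S\<close> unfolding is_interval_1 by blast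
    obtain c where c: "x < c" "c < z" "f z - f x = (z - x) * f' c"
      using MVT2[OF \<open>x < z\<close>, of f f'] der in_S \<open>z < y\<close> by fastforce
    obtain d where d: "z < d" "d < y" "f y - f z = (y - z) * f' d"
      using MVT2[OF \<open>z < y\<close>, of f f'] der in_S \<open>x < z\<close> by fastforce
    have "f' c < f' d"
      using mono in_S c d unfolding strict_mono_on_def by auto
    then have "u * v * (y - x) * f' c < u * v * (y - x) * f' d"
      using uv \<open>x < y\<close> by simp
    then have "u * (f z - f x) < v * (f y - f z)"
      unfolding c(3) d(3) zx yz by (simp add: mult_ac)
    then have "f z < u * f x + v * f y" unfolding u by (simp add: algebra_simps)
    then show ?thesis unfolding z_def .
  qed
  have "f (u *\<^sub>R x + v *\<^sub>R y) < u * f x + v * f y"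
    if "x \<in> S" "y \<in> S" "u > 0" "v > 0" "x \<noteq> y" "u + v = 1" for x y u v
  proof (cases "x < y")
    case True
    then show ?thesis using less[of x y u v] that by simp
  next
    case False
    then show ?thesis using less[of y x v u] that by (simp add: add.commute)
  qed
  then show ?thesis using S unfolding strictly_convex_on_def by blast
qed

text \<open>The signs make \<open>f\<close> nonincreasing up to \<open>s\<close> and nondecreasing
  after it, so \<open>{a<..<b}\<close> itself serves as the neighbourhood.\<close>

lemma local_minimum_if_deriv_sign_change:
  assumes "a < s" "s < b"
    and der: "\<And>x. a < x \<Longrightarrow> x < b \<Longrightarrow> (f has_real_derivative f' x) (at x)"
    and left: "\<And>x. a < x \<Longrightarrow> x \<le> s \<Longrightarrow> f' x \<le> 0"
    and right: "\<And>x. s \<le> x \<Longrightarrow> x < b \<Longrightarrow> f' x \<ge> 0"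
  shows "local_minimum f s"
proof -
  have "f s \<le> f x" if x: "a < x" "x < b" for x
  proof (cases "x \<le> s")
    case True
    show ?thesis
    proof (rule DERIV_nonpos_imp_nonincreasing[OF True])
      fix t assume "x \<le> t" "t \<le> s"
      then show "\<exists>y. (f has_real_derivative y) (at t) \<and> y \<le> 0"
        using der[of t] left[of t] x assms(2) by (intro exI[of _ "f' t"]) auto
    qed
  next
    case False
    then have "s \<le> x" by simp
    then show ?thesis
    proof (rule DERIV_nonneg_imp_nondecreasing)
      fix t assume "s \<le> t" "t \<le> x"
      then show "\<exists>y. (f has_real_derivative y) (at t) \<and> 0 \<le> y"
        using der[of t] right[of t] x assms(1) by (intro exI[of _ "f' t"]) auto
    qed
  qed
  then have "\<forall>x\<in>{a<..<b}. f s \<le> f x" by simp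
  then show ?thesis
    unfolding local_minimum_def eventually_nhds
    using assms(1,2) by (intro exI[of _ "{a<..<b}"]) auto
qed

lemma local_maximum_if_deriv_sign_change:
  assumes "a < s" "s < b"
    and der: "\<And>x. a < x \<Longrightarrow> x < b \<Longrightarrow> (f has_real_derivative f' x) (at x)"
    and "\<And>x. a < x \<Longrightarrow> x \<le> s \<Longrightarrow> f' x \<ge> 0"
    and "\<And>x. s \<le> x \<Longrightarrow> x < b \<Longrightarrow> f' x \<le> 0"
  shows "local_maximum f s"
proof -
  have "local_minimum (\<lambda>x. - f x) s"
    by (rule local_minimum_if_deriv_sign_change[of a s b _ "\<lambda>x. - f' x"])
      (use assms in \<open>auto intro!: derivative_intros\<close>)
  then show ?thesis
    unfolding local_minimum_def local_maximum_def by simp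
qed

lemma strict_mono_on_if_deriv_pos:
  fixes f f' :: "real \<Rightarrow> real"
  assumes "convex S"
    and der: "\<And>x. (f has_real_derivative f' x) (at x)"
    and pos: "\<And>x. x \<in> S \<Longrightarrow> f' x > 0"
  shows "strict_mono_on S f"
proof (rule strict_mono_onI)
  fix x y assume "x \<in> S" "y \<in> S" "x < y"
  have "is_interval S" using assms(1) by (simp add: is_interval_convex_1)
  then have "t \<in> S" if "x \<le> t" "t \<le> y" for t
    using that \<open>x \<in> S\<close> \<open>y \<in> S\<close> unfolding is_interval_1 by blast
  then show "f x < f y"
    using \<open>x < y\<close> der pos by (intro DERIV_pos_imp_increasing[of x y f]) blast+
qed

section \<open>The derivatives of \<open>J\<close> and the stationarity equation\<close>

text \<open>Half of the derivative of \<open>J \<sigma> k\<close>; without the factor 2 it is the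
  difference of the two sides of the stationarity equation.\<close>

definition half_deriv :: "real \<Rightarrow> real \<Rightarrow> real \<Rightarrow> real" where
  "half_deriv \<sigma> k s = k\<^sup>2 * (s - \<sigma>) + s / (1 + s\<^sup>2)\<^sup>2"

lemma one_plus_square_neq_0: "1 + s\<^sup>2 \<noteq> (0::real)"
  by (smt (verit) zero_le_power2)

lemma J_has_derivative: "(J \<sigma> k has_real_derivative 2 * half_deriv \<sigma> k s) (at s)"
proof -
  have "((\<lambda>s. k\<^sup>2 * (\<sigma> - s)\<^sup>2 + s\<^sup>2 / (1 + s\<^sup>2)) has_real_derivative
      k\<^sup>2 * (2 * (\<sigma> - s) * (-1)) + (2 * s * (1 + s\<^sup>2) - s\<^sup>2 * (2 * s)) / ((1 + s\<^sup>2) * (1 + s\<^sup>2)))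
      (at s)"
    by (auto intro!: derivative_eq_intros simp: one_plus_square_neq_0)
  moreover have "k\<^sup>2 * (2 * (\<sigma> - s) * (-1)) + (2 * s * (1 + s\<^sup>2) - s\<^sup>2 * (2 * s)) / ((1 + s\<^sup>2) * (1 + s\<^sup>2))
      = 2 * half_deriv \<sigma> k s"
    unfolding half_deriv_def by (simp add: algebra_simps power2_eq_square)
  moreover have "J \<sigma> k = (\<lambda>s. k\<^sup>2 * (\<sigma> - s)\<^sup>2 + s\<^sup>2 / (1 + s\<^sup>2))"
    by (simp add: J_def fun_eq_iff)
  ultimately show ?thesis by simp
qed

lemma half_deriv_has_derivative:
  "(half_deriv \<sigma> k has_real_derivative k\<^sup>2 + (1 - 3 * s\<^sup>2) / (1 + s\<^sup>2) ^ 3) (at s)"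
proof -
  have "((\<lambda>s. k\<^sup>2 * (s - \<sigma>) + s / (1 + s\<^sup>2)\<^sup>2) has_real_derivative
      k\<^sup>2 + ((1 + s\<^sup>2)\<^sup>2 - s * (2 * (1 + s\<^sup>2) * (2 * s))) / ((1 + s\<^sup>2)\<^sup>2 * (1 + s\<^sup>2)\<^sup>2)) (at s)"
    by (auto intro!: derivative_eq_intros simp: one_plus_square_neq_0)
  \<comment> \<open>The factor \<open>1 + s\<^sup>2\<close> is split off but not yet cancelled, so
    numerators and denominators agree separately as polynomials.\<close>
  moreover have "((1 + s\<^sup>2)\<^sup>2 - s * (2 * (1 + s\<^sup>2) * (2 * s))) / ((1 + s\<^sup>2)\<^sup>2 * (1 + s\<^sup>2)\<^sup>2)
      = ((1 + s\<^sup>2) * (1 - 3 * s\<^sup>2)) / ((1 + s\<^sup>2) * (1 + s\<^sup>2) ^ 3)"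
    by (rule arg_cong2[of _ _ _ _ "(/)"]) (simp_all add: algebra_simps power2_eq_square eval_nat_numeral)
  moreover have "half_deriv \<sigma> k = (\<lambda>s. k\<^sup>2 * (s - \<sigma>) + s / (1 + s\<^sup>2)\<^sup>2)"
    by (simp add: half_deriv_def fun_eq_iff)
  ultimately show ?thesis by (simp add: one_plus_square_neq_0)
qed

lemma continuous_on_half_deriv: "continuous_on S (half_deriv \<sigma> k)"
  by (meson DERIV_isCont continuous_at_imp_continuous_on half_deriv_has_derivative)

lemma stationarity_eq_iff_half_deriv: "stationarity_eq \<sigma> k s \<longleftrightarrow> half_deriv \<sigma> k s = 0"
  unfolding stationarity_eq_def half_deriv_def by (auto simp: algebra_simps)

lemma stationary_point_iff_stationarity_eq:
  "stationary_point (J \<sigma> k) s \<longleftrightarrow> stationarity_eq \<sigma> k s"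
  unfolding stationary_point_def stationarity_eq_iff_half_deriv
  using J_has_derivative[of \<sigma> k s] DERIV_unique by fastforce

lemma stationarity_eq_iff_quintic: "stationarity_eq \<sigma> k s \<longleftrightarrow> stationarity_quintic \<sigma> k s"
proof -
  have "(1 + s\<^sup>2)\<^sup>2 = 1 + 2 * s\<^sup>2 + s ^ 4"
    by (simp add: power2_eq_square eval_nat_numeral algebra_simps)
  moreover have "(1 + s\<^sup>2)\<^sup>2 \<noteq> 0" by (simp add: one_plus_square_neq_0)
  ultimately show ?thesis
    unfolding stationarity_eq_def stationarity_quintic_def by (simp add: eq_divide_eq)
qed

section \<open>Existence and stationarity of global minimizers\<close>

text \<open>The quadratic term vanishes at \<open>\<sigma>\<close> and the fraction grows with
  \<open>t\<^sup>2\<close>. This reduces the minimization to the compact interval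
  \<open>{0..\<sigma>}\<close>.\<close>

lemma J_mono_beyond:
  assumes "\<sigma> > 0" "t \<ge> \<sigma>"
  shows "J \<sigma> k \<sigma> \<le> J \<sigma> k t"
proof -
  have frac: "x\<^sup>2 / (1 + x\<^sup>2) = 1 - 1 / (1 + x\<^sup>2)" for x :: real
    using one_plus_square_neq_0[of x] by (simp add: field_simps)
  have "\<sigma>\<^sup>2 \<le> t\<^sup>2" using assms by (simp add: power_mono)
  then have "\<sigma>\<^sup>2 / (1 + \<sigma>\<^sup>2) \<le> t\<^sup>2 / (1 + t\<^sup>2)"
    unfolding frac using sum_power2_gt_zero_iff[of 1 \<sigma>] by (simp add: frac_le add_pos_nonneg)
  moreover have "0 \<le> k\<^sup>2 * (\<sigma> - t)\<^sup>2" by simp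
  moreover have "k\<^sup>2 * (\<sigma> - \<sigma>)\<^sup>2 = 0" by simp
  ultimately show ?thesis unfolding J_def by linarith
qed

lemma J_attains_minimum:
  assumes "\<sigma> > 0" "k > 0"
  obtains s where "s > 0" "\<And>t. t > 0 \<Longrightarrow> J \<sigma> k s \<le> J \<sigma> k t"
proof -
  have "continuous_on {0..\<sigma>} (J \<sigma> k)"
    by (meson DERIV_isCont continuous_at_imp_continuous_on J_has_derivative)
  then obtain s where s: "s \<in> {0..\<sigma>}" "\<And>t. t \<in> {0..\<sigma>} \<Longrightarrow> J \<sigma> k s \<le> J \<sigma> k t"
    using continuous_attains_inf[of "{0..\<sigma>}" "J \<sigma> k"] assms by auto
  \<comment> \<open>The slope at 0 is \<open>- 2 * k\<^sup>2 * \<sigma>\<close>, so points just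
    right of 0 have smaller values and the minimizer is not 0.\<close>
  have "2 * half_deriv \<sigma> k 0 < 0" using assms by (simp add: half_deriv_def)
  from DERIV_neg_dec_right[OF J_has_derivative this]
  obtain d where d: "d > 0" "\<And>h. h > 0 \<Longrightarrow> h < d \<Longrightarrow> J \<sigma> k h < J \<sigma> k 0" by auto
  \<comment> \<open>Halving \<open>d\<close> keeps \<open>h\<close> strictly below it; the bound
    \<open>\<sigma>\<close> keeps \<open>h\<close> where \<open>s\<close> is known to be
    minimal.\<close>
  define h where "h = min (d / 2) \<sigma>"
  have "h > 0" "h < d" "h \<le> \<sigma>" using d(1) assms unfolding h_def by auto
  then have "J \<sigma> k h < J \<sigma> k 0" "J \<sigma> k s \<le> J \<sigma> k h" using d s(2)[of h] by auto
  then have "s > 0" using s(1) by (cases "s = 0") auto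
  moreover have "J \<sigma> k s \<le> J \<sigma> k t" if "t > 0" for t
  proof (cases "t \<le> \<sigma>")
    case True
    then show ?thesis using s(2)[of t] that by simp
  next
    case False
    then show ?thesis using s(2)[of \<sigma>] J_mono_beyond[of \<sigma> t k] assms by simp
  qed
  ultimately show ?thesis using that by blast
qed

text \<open>Since the minimum is attained, the infimum \<open>JG \<sigma> k\<close> is a value of
  \<open>J\<close>, and later arguments can compare values directly.\<close>

lemma global_minimizer_iff:
  assumes "\<sigma> > 0" "k > 0"
  shows "global_minimizer \<sigma> k s \<longleftrightarrow> s > 0 \<and> (\<forall>t>0. J \<sigma> k s \<le> J \<sigma> k t)"
proof -
  obtain m where m: "m > 0" "\<And>t. t > 0 \<Longrightarrow> J \<sigma> k m \<le> J \<sigma> k t"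
    using J_attains_minimum[OF assms] by metis
  have "JG \<sigma> k = J \<sigma> k m"
    unfolding JG_def by (rule cInf_eq_minimum) (use m in auto)
  then show ?thesis
    unfolding global_minimizer_def using m by (metis order_antisym)
qed

lemma global_minimizer_imp_stationarity_eq:
  assumes "\<sigma> > 0" "k > 0" "global_minimizer \<sigma> k s"
  shows "stationarity_eq \<sigma> k s"
proof -
  have s: "s > 0" "\<forall>t>0. J \<sigma> k s \<le> J \<sigma> k t"
    using assms global_minimizer_iff by blast+
  \<comment> \<open>Fermat's criterion with radius \<open>s\<close>: every point closer than
    \<open>s\<close> to \<open>s\<close> is positive.\<close>
  have "2 * half_deriv \<sigma> k s = 0"
    by (rule DERIV_local_min[OF J_has_derivative s(1)]) (use s(2) in auto)
  then show ?thesis by (simp add: stationarity_eq_iff_half_deriv)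
qed

section \<open>Monotonicity of the derivative above the threshold 1/4\<close>

text \<open>The threshold is sharp for this bound: \<open>(1 - 3 * u) / (1 + u) ^ 3\<close> has
  minimum -1/4 over \<open>u \<ge> 0\<close>, attained at \<open>u = 1\<close>, the double root in
  the factorization below.\<close>

lemma strict_mono_half_deriv:
  assumes "k\<^sup>2 > 1/4"
  shows "strict_mono_on {0<..} (half_deriv \<sigma> k)"
proof (rule strict_mono_on_if_deriv_pos[OF _ half_deriv_has_derivative])
  show "k\<^sup>2 + (1 - 3 * s\<^sup>2) / (1 + s\<^sup>2) ^ 3 > 0" for s
  proof -
    define u where "u = s\<^sup>2"
    have "u \<ge> 0" unfolding u_def by simp
    have "4 * (1 - 3 * u) + (1 + u) ^ 3 = (u - 1)\<^sup>2 * (u + 5)"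
      by (simp add: power2_eq_square eval_nat_numeral algebra_simps)
    moreover have "\<dots> \<ge> 0" using \<open>u \<ge> 0\<close> by simp
    ultimately have "- (1 / 4) * (1 + u) ^ 3 \<le> 1 - 3 * u" by argo
    moreover have "(1 + u) ^ 3 > 0" using \<open>u \<ge> 0\<close> by simp
    ultimately have "- (1 / 4) \<le> (1 - 3 * u) / (1 + u) ^ 3"
      by (simp only: pos_le_divide_eq)
    then show ?thesis using assms unfolding u_def by simp
  qed
qed (simp add: convex_real_interval)

section \<open>The instance with \<open>\<sigma> = 5\<close> and \<open>k = 0.2\<close>\<close>

text \<open>Over a common positive denominator, the monotonicity of \<open>half_deriv 5 0.2\<close>
  is decided by the sign of the cubic \<open>u ^ 3 + 3 * u\<^sup>2 - 72 * u + 26\<close> in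
  \<open>u = s\<^sup>2\<close>.\<close>

lemma half_deriv_5_has_derivative:
  "(half_deriv 5 0.2 has_real_derivative
     ((s\<^sup>2) ^ 3 + 3 * (s\<^sup>2)\<^sup>2 - 72 * s\<^sup>2 + 26) / (25 * (1 + s\<^sup>2) ^ 3)) (at s)"
proof -
  have "(0.2::real)\<^sup>2 + (1 - 3 * s\<^sup>2) / (1 + s\<^sup>2) ^ 3
      = ((s\<^sup>2) ^ 3 + 3 * (s\<^sup>2)\<^sup>2 - 72 * s\<^sup>2 + 26) / (25 * (1 + s\<^sup>2) ^ 3)"
  proof -
    define u where "u = s\<^sup>2"
    define w where "w = (1 + u) ^ 3"
    have "w \<noteq> 0" using one_plus_square_neq_0[of s] unfolding u_def w_def by simp
    then have "1 / 25 + (1 - 3 * u) / w = (w + 25 * (1 - 3 * u)) / (25 * w)"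
      by (simp add: field_simps)
    moreover have "w + 25 * (1 - 3 * u) = u ^ 3 + 3 * u\<^sup>2 - 72 * u + 26"
      unfolding w_def by (simp add: power2_eq_square eval_nat_numeral algebra_simps)
    ultimately have "1 / 25 + (1 - 3 * u) / (1 + u) ^ 3 = (u ^ 3 + 3 * u\<^sup>2 - 72 * u + 26) / (25 * (1 + u) ^ 3)"
      unfolding w_def by simp
    then show ?thesis unfolding u_def by (simp add: power2_eq_square)
  qed
  then show ?thesis using half_deriv_has_derivative[of 5 "0.2" s] by simp
qed

text \<open>For \<open>u \<le> 1/4\<close> the negative term of the cubic is at most 18 in size,
  less than 26. For \<open>u \<ge> 9\<close> the cubic is at least
  \<open>12 * u\<^sup>2 - 72 * u + 26\<close>, hence at least \<open>36 * u + 26\<close>.\<close>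

lemma half_deriv_5_strict_mono:
  "strict_mono_on {0..1/2} (half_deriv 5 0.2)"
  "strict_mono_on {3..} (half_deriv 5 0.2)"
proof -
  have den: "25 * (1 + s\<^sup>2) ^ 3 > 0" for s :: real
    by (simp add: add_pos_nonneg)
  show "strict_mono_on {0..1/2} (half_deriv 5 0.2)"
  proof (rule strict_mono_on_if_deriv_pos[OF _ half_deriv_5_has_derivative])
    fix s :: real assume "s \<in> {0..1/2}"
    then have "s\<^sup>2 \<le> (1/2)\<^sup>2" by (intro power_mono) auto
    then have "72 * s\<^sup>2 \<le> 18" by (simp add: power2_eq_square)
    moreover have "(s\<^sup>2) ^ 3 \<ge> 0" "(s\<^sup>2)\<^sup>2 \<ge> 0" by simp_all
    ultimately show "((s\<^sup>2) ^ 3 + 3 * (s\<^sup>2)\<^sup>2 - 72 * s\<^sup>2 + 26) / (25 * (1 + s\<^sup>2) ^ 3) > 0"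
      by (intro divide_pos_pos den) linarith
  qed simp
  show "strict_mono_on {3..} (half_deriv 5 0.2)"
  proof (rule strict_mono_on_if_deriv_pos[OF _ half_deriv_5_has_derivative])
    fix s :: real assume "s \<in> {3..}"
    then have u: "s\<^sup>2 \<ge> 9" using power_mono[of 3 s 2] by simp
    then have "(s\<^sup>2)\<^sup>2 \<ge> 9 * s\<^sup>2"
      unfolding power2_eq_square[of "s\<^sup>2"] by (intro mult_right_mono) auto
    moreover have "(s\<^sup>2) ^ 3 = s\<^sup>2 * (s\<^sup>2)\<^sup>2" by (simp add: eval_nat_numeral)
    moreover have "s\<^sup>2 * (s\<^sup>2)\<^sup>2 \<ge> 9 * (s\<^sup>2)\<^sup>2" using u by (intro mult_right_mono) auto
    ultimately show "((s\<^sup>2) ^ 3 + 3 * (s\<^sup>2)\<^sup>2 - 72 * s\<^sup>2 + 26) / (25 * (1 + s\<^sup>2) ^ 3) > 0"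
      using u by (intro divide_pos_pos den) linarith
  qed simp
qed

text \<open>For \<open>1 \<le> u \<le> 4\<close> the cubic is at most
  \<open>7 * u\<^sup>2 - 72 * u + 26\<close>, hence at most \<open>26 - 44 * u\<close>, which is
  negative.\<close>

lemma half_deriv_5_strict_antimono:
  "strict_mono_on {1..2} (\<lambda>s. - half_deriv 5 0.2 s)"
proof (rule strict_mono_on_if_deriv_pos[OF _ DERIV_minus[OF half_deriv_5_has_derivative]])
  fix s :: real assume "s \<in> {1..2}"
  then have u: "s\<^sup>2 \<le> 4" "s\<^sup>2 \<ge> 1" using power_mono[of s 2 2] power_mono[of 1 s 2] by auto
  then have "(s\<^sup>2)\<^sup>2 \<le> 4 * s\<^sup>2"
    unfolding power2_eq_square[of "s\<^sup>2"] by (intro mult_right_mono) auto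
  moreover have "(s\<^sup>2) ^ 3 = s\<^sup>2 * (s\<^sup>2)\<^sup>2" by (simp add: eval_nat_numeral)
  moreover have "s\<^sup>2 * (s\<^sup>2)\<^sup>2 \<le> 4 * (s\<^sup>2)\<^sup>2" using u by (intro mult_right_mono) auto
  ultimately have "(s\<^sup>2) ^ 3 + 3 * (s\<^sup>2)\<^sup>2 - 72 * s\<^sup>2 + 26 < 0" using u by linarith
  moreover have "25 * (1 + s\<^sup>2) ^ 3 > 0" by (simp add: add_pos_nonneg)
  ultimately show "- (((s\<^sup>2) ^ 3 + 3 * (s\<^sup>2)\<^sup>2 - 72 * s\<^sup>2 + 26) / (25 * (1 + s\<^sup>2) ^ 3)) > 0"
    by (simp add: divide_neg_pos)
qed simp

text \<open>Here \<open>(5 - s) / 25\<close> is at most 9/50, its value at \<open>s = 1/2\<close>,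
  so it suffices that the fraction exceeds 9/50.\<close>

lemma half_deriv_5_pos:
  assumes "1/2 \<le> s" "s \<le> 1"
  shows "half_deriv 5 0.2 s > 0"
proof -
  \<comment> \<open>This bounds the parabola by its chord over \<open>[1/2, 1]\<close>; applied
    twice, it leaves a linear inequality in \<open>s\<close>.\<close>
  have "(s - 1/2) * (1 - s) \<ge> 0" using assms by simp
  then have sq: "s\<^sup>2 \<le> 3/2 * s - 1/2" by (simp add: power2_eq_square field_simps)
  then have "(1 + s\<^sup>2)\<^sup>2 \<le> (1/2 + 3/2 * s)\<^sup>2" by (intro power_mono) auto
  also have "\<dots> = 1/4 + 3/2 * s + 9/4 * s\<^sup>2" by (simp add: power2_eq_square algebra_simps)
  finally have "(1 + s\<^sup>2)\<^sup>2 < 50/9 * s" using sq assms by linarith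
  then have "9/50 < s / (1 + s\<^sup>2)\<^sup>2"
    by (simp add: pos_less_divide_eq zero_less_power2 one_plus_square_neq_0)
  then show ?thesis
    unfolding half_deriv_def using assms by (simp only: power2_eq_square[of "0.2"]) argo
qed

text \<open>Here \<open>(5 - s) / 25\<close> is at least 2/25, its value at \<open>s = 3\<close>,
  while the fraction is at most 2/25, its value at \<open>s = 2\<close>.\<close>

lemma half_deriv_5_neg:
  assumes "2 \<le> s" "s \<le> 3"
  shows "half_deriv 5 0.2 s < 0"
proof -
  \<comment> \<open>This bounds the parabola from below by its tangent at 2, where the estimate of
    the fraction is tight.\<close>
  have "(s - 2)\<^sup>2 \<ge> 0" by simp
  then have sq: "1 + s\<^sup>2 \<ge> 4 * s - 3" by (simp add: power2_eq_square algebra_simps)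
  have "(1 + s\<^sup>2)\<^sup>2 \<ge> 5 * (1 + s\<^sup>2)"
    using sq assms by (simp only: power2_eq_square[of "1 + s\<^sup>2"]) (intro mult_right_mono; linarith)
  moreover have "25/2 * s \<le> 5 * (1 + s\<^sup>2)" using sq assms by argo
  ultimately have "25/2 * s \<le> (1 + s\<^sup>2)\<^sup>2" by (rule order_trans[rotated])
  then have "s / (1 + s\<^sup>2)\<^sup>2 \<le> 2/25"
    by (simp add: pos_divide_le_eq zero_less_power2 one_plus_square_neq_0)
  \<comment> \<open>Strictness: the two bounds by 2/25 are not both attained at the same
    \<open>s\<close>.\<close>
  moreover have "s < 3 \<or> s / (1 + s\<^sup>2)\<^sup>2 < 2/25" using assms by (cases "s = 3") simp_all
  ultimately show ?thesis
    unfolding half_deriv_def using assms by (simp only: power2_eq_square[of "0.2"]) argo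
qed

text \<open>The derivative decreases on \<open>[1, 2]\<close>, so midpoint convexity fails there:
  the value at 3/2 is about 1.18, the mean of the values at 1 and 2 is 1.15.\<close>

lemma J_5_not_convex: "\<not> convex_on {0<..} (J 5 0.2)"
proof
  assume "convex_on {0<..} (J 5 0.2)"
  from convex_onD[OF this, of "1/2" 1 2]
  have "J 5 0.2 (3/2) \<le> 1/2 * J 5 0.2 1 + 1/2 * J 5 0.2 2" by simp
  then show False unfolding J_def by (simp add: power2_eq_square)
qed

lemma J_5_three_stationary_points:
  obtains s1 s2 s3 where "0 < s1" "s1 < s2" "s2 < s3"
    "{s. s > 0 \<and> stationarity_eq 5 0.2 s} = {s1, s2, s3}"
    "local_minimum (J 5 0.2) s1" "local_maximum (J 5 0.2) s2" "local_minimum (J 5 0.2) s3"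
proof -
  let ?D = "half_deriv 5 0.2"
  \<comment> \<open>These signs bracket one root in each of \<open>[0, 1/2]\<close>,
    \<open>[1, 2]\<close> and \<open>[3, 5]\<close>.\<close>
  have "?D 0 < 0" "?D 5 > 0" "?D (1/2) > 0" "?D 1 > 0" "?D 2 < 0" "?D 3 < 0"
    by (simp_all add: half_deriv_def power2_eq_square)
  note D = this
  obtain s1 where s1: "0 \<le> s1" "s1 \<le> 1/2" "?D s1 = 0"
    using IVT'[of ?D 0 0 "1/2"] D continuous_on_half_deriv by auto
  obtain s2 where s2: "1 \<le> s2" "s2 \<le> 2" "?D s2 = 0"
    using IVT2'[of ?D 2 0 1] D continuous_on_half_deriv by auto
  obtain s3 where s3: "3 \<le> s3" "s3 \<le> 5" "?D s3 = 0"
    using IVT'[of ?D 3 0 5] D continuous_on_half_deriv by auto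
  \<comment> \<open>Strict bounds give each root room on both sides for the sign-change
    criteria.\<close>
  have "s1 \<noteq> 0" "s1 \<noteq> 1/2" "s2 \<noteq> 1" "s2 \<noteq> 2" "s3 \<noteq> 3"
    using s1(3) s2(3) s3(3) D by (metis less_irrefl)+
  then have bounds: "0 < s1" "s1 < 1/2" "1 < s2" "s2 < 2" "3 < s3"
    using s1 s2 s3 by auto
  have less1: "?D x < ?D y" if "0 \<le> x" "x < y" "y \<le> 1/2" for x y
    using strict_mono_onD[OF half_deriv_5_strict_mono(1), of x y] that by simp
  have less2: "?D y < ?D x" if "1 \<le> x" "x < y" "y \<le> 2" for x y
    using strict_mono_onD[OF half_deriv_5_strict_antimono, of x y] that by simp
  have less3: "?D x < ?D y" if "3 \<le> x" "x < y" for x y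
    using strict_mono_onD[OF half_deriv_5_strict_mono(2), of x y] that by simp
  have "s = s1 \<or> s = s2 \<or> s = s3" if "s > 0" "?D s = 0" for s
  proof -
    consider "s \<le> 1/2" | "1/2 \<le> s" "s \<le> 1" | "1 \<le> s" "s \<le> 2" | "2 \<le> s" "s \<le> 3" | "3 \<le> s"
      by linarith
    then show ?thesis
    proof cases
      case 1
      then show ?thesis
        using less1[of s s1] less1[of s1 s] that s1 by (cases s s1 rule: linorder_cases) auto
    next
      case 3
      then show ?thesis
        using less2[of s s2] less2[of s2 s] that s2 by (cases s s2 rule: linorder_cases) auto
    next
      case 5
      then show ?thesis
        using less3[of s s3] less3[of s3 s] that s3 by (cases s s3 rule: linorder_cases) auto
    qed (use half_deriv_5_pos[of s] half_deriv_5_neg[of s] that in auto)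
  qed
  then have roots: "{s. s > 0 \<and> stationarity_eq 5 0.2 s} = {s1, s2, s3}"
    unfolding stationarity_eq_iff_half_deriv using s1 s2 s3 bounds by auto
  have "local_minimum (J 5 0.2) s1"
  proof (rule local_minimum_if_deriv_sign_change[OF bounds(1,2) J_has_derivative])
    show "2 * ?D x \<le> 0" if "0 < x" "x \<le> s1" for x
      using less1[of x s1] that s1 by (cases "x = s1") auto
    show "0 \<le> 2 * ?D x" if "s1 \<le> x" "x < 1/2" for x
      using less1[of s1 x] that s1 by (cases "x = s1") auto
  qed
  moreover have "local_maximum (J 5 0.2) s2"
  proof (rule local_maximum_if_deriv_sign_change[OF bounds(3,4) J_has_derivative])
    show "0 \<le> 2 * ?D x" if "1 < x" "x \<le> s2" for x
      using less2[of x s2] that s2 by (cases "x = s2") auto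
    show "2 * ?D x \<le> 0" if "s2 \<le> x" "x < 2" for x
      using less2[of s2 x] that s2 by (cases "x = s2") auto
  qed
  moreover have "local_minimum (J 5 0.2) s3"
  proof (rule local_minimum_if_deriv_sign_change[OF bounds(5) _ J_has_derivative])
    \<comment> \<open>The right end is arbitrary, since \<open>?D\<close> increases on all of
      \<open>{3..}\<close>.\<close>
    show "s3 < s3 + 1" by simp
    show "2 * ?D x \<le> 0" if "3 < x" "x \<le> s3" for x
      using less3[of x s3] that s3 by (cases "x = s3") auto
    show "0 \<le> 2 * ?D x" if "s3 \<le> x" "x < s3 + 1" for x
      using less3[of s3 x] that s3 by (cases "x = s3") auto
  qed
  ultimately show ?thesis
    using that[of s1 s2 s3] roots bounds by simp
qed

section \<open>Assembly of the claims\<close>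

theorem proposition3p15:
  fixes \<sigma> k :: real
  assumes "\<sigma> > 0" and "k > 0"
  shows "(\<exists>s. global_minimizer \<sigma> k s)
    \<and> (\<forall>s>0. (stationary_point (J \<sigma> k) s \<longleftrightarrow> stationarity_eq \<sigma> k s)
            \<and> (stationarity_eq \<sigma> k s \<longleftrightarrow> stationarity_quintic \<sigma> k s))
    \<and> (k\<^sup>2 > 1/4 \<longrightarrow>
          strictly_convex_on {0<..} (J \<sigma> k)
        \<and> (\<exists>!s. s > 0 \<and> stationarity_eq \<sigma> k s)
        \<and> (\<exists>!s. global_minimizer \<sigma> k s))
    \<and> (k\<^sup>2 \<le> 1/4 \<longrightarrow>
          (\<forall>s. global_minimizer \<sigma> k s \<longleftrightarrow>
                s > 0 \<and> stationarity_eq \<sigma> k s \<and>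
                (\<forall>t>0. stationarity_eq \<sigma> k t \<longrightarrow> J \<sigma> k s \<le> J \<sigma> k t)))
    \<and> (\<exists>\<sigma>' k'. \<sigma>' > 0 \<and> k' > 0 \<and> k'\<^sup>2 \<le> 1/4
          \<and> \<not> convex_on {0<..} (J \<sigma>' k')
          \<and> (\<exists>s t. 0 < s \<and> s < t \<and> stationarity_eq \<sigma>' k' s \<and> stationarity_eq \<sigma>' k' t))
    \<and> \<not> convex_on {0<..} (J 5 0.2)
    \<and> (\<exists>s1 s2 s3. 0 < s1 \<and> s1 < s2 \<and> s2 < s3
          \<and> {s. s > 0 \<and> stationarity_eq 5 0.2 s} = {s1, s2, s3}
          \<and> local_minimum (J 5 0.2) s1
          \<and> local_maximum (J 5 0.2) s2
          \<and> local_minimum (J 5 0.2) s3)"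
proof (intro conjI)
  obtain m where m: "global_minimizer \<sigma> k m"
    using J_attains_minimum[OF assms] global_minimizer_iff[OF assms] by metis
  then show "\<exists>s. global_minimizer \<sigma> k s" by blast
  have stat: "s > 0" "stationarity_eq \<sigma> k s" if "global_minimizer \<sigma> k s" for s
    using that global_minimizer_imp_stationarity_eq[OF assms] by (auto simp: global_minimizer_def)
  show "\<forall>s>0. (stationary_point (J \<sigma> k) s \<longleftrightarrow> stationarity_eq \<sigma> k s)
            \<and> (stationarity_eq \<sigma> k s \<longleftrightarrow> stationarity_quintic \<sigma> k s)"
    using stationary_point_iff_stationarity_eq stationarity_eq_iff_quintic by blast
  show "k\<^sup>2 > 1/4 \<longrightarrow>
          strictly_convex_on {0<..} (J \<sigma> k)
        \<and> (\<exists>!s. s > 0 \<and> stationarity_eq \<sigma> k s)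
        \<and> (\<exists>!s. global_minimizer \<sigma> k s)"
  proof (intro impI conjI)
    assume "k\<^sup>2 > 1/4"
    from strict_mono_half_deriv[OF this, of \<sigma>]
    have mono: "strict_mono_on {0<..} (half_deriv \<sigma> k)" .
    then have "strict_mono_on {0<..} (\<lambda>s. 2 * half_deriv \<sigma> k s)"
      unfolding strict_mono_on_def by simp
    then show "strictly_convex_on {0<..} (J \<sigma> k)"
      using strictly_convex_on_if_deriv_strict_mono_on[OF _ J_has_derivative]
      by (simp add: convex_real_interval)
    have "s = t" if "s > 0" "t > 0" "stationarity_eq \<sigma> k s" "stationarity_eq \<sigma> k t" for s t
      using strict_mono_on_eqD[OF mono, of s t] that by (simp add: stationarity_eq_iff_half_deriv)
    \<comment> \<open>The minimizer \<open>m\<close> witnesses both existence claims; since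
      minimizers are stationary, uniqueness of the root carries over to them.\<close>
    then show "\<exists>!s. s > 0 \<and> stationarity_eq \<sigma> k s" "\<exists>!s. global_minimizer \<sigma> k s"
      using m stat by metis+
  qed
  \<comment> \<open>The minimizer \<open>m\<close> is itself stationary, so a point that is best
    among the stationary ones has value at most \<open>J \<sigma> k m\<close>.\<close>
  show "k\<^sup>2 \<le> 1/4 \<longrightarrow>
          (\<forall>s. global_minimizer \<sigma> k s \<longleftrightarrow>
                s > 0 \<and> stationarity_eq \<sigma> k s \<and>
                (\<forall>t>0. stationarity_eq \<sigma> k t \<longrightarrow> J \<sigma> k s \<le> J \<sigma> k t))"
    using stat m global_minimizer_iff[OF assms] by (meson order_trans)
  show "\<exists>\<sigma>' k'. \<sigma>' > 0 \<and> k' > 0 \<and> k'\<^sup>2 \<le> 1/4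
          \<and> \<not> convex_on {0<..} (J \<sigma>' k')
          \<and> (\<exists>s t. 0 < s \<and> s < t \<and> stationarity_eq \<sigma>' k' s \<and> stationarity_eq \<sigma>' k' t)"
  proof (rule exI[of _ 5], rule exI[of _ "0.2"], intro conjI)
    obtain s1 s2 s3 where s: "0 < s1" "s1 < s2"
      "{s. s > 0 \<and> stationarity_eq 5 0.2 s} = {s1, s2, s3}"
      by (rule J_5_three_stationary_points)
    then have "stationarity_eq 5 0.2 s1" "stationarity_eq 5 0.2 s2" by auto
    then show "\<exists>s t. 0 < s \<and> s < t \<and> stationarity_eq 5 0.2 s \<and> stationarity_eq 5 0.2 t"
      using s by blast
  qed (use J_5_not_convex in \<open>simp_all add: power2_eq_square\<close>)
  show "\<not> convex_on {0<..} (J 5 0.2)" by (rule J_5_not_convex)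
  show "\<exists>s1 s2 s3. 0 < s1 \<and> s1 < s2 \<and> s2 < s3
          \<and> {s. s > 0 \<and> stationarity_eq 5 0.2 s} = {s1, s2, s3}
          \<and> local_minimum (J 5 0.2) s1
          \<and> local_maximum (J 5 0.2) s2
          \<and> local_minimum (J 5 0.2) s3"
    by (rule J_5_three_stationary_points) blast
qed

end
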